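(* Let $\alpha>0$ and let $F$ be a continuous distribution function supported on $[1,\infty)$ with $\overline{F}=1-F\in \mathrm{RV}_{-\alpha}$. Let $(X_i)_{i\ge1}$ be i.i.d. with distribution function $F$, and let $(k_n)_{n\ge1}$ be a random intermediate sequence. Then Hill's estimator with $k=k_n$ is consistent, i.e. $\widehat\alpha_{n,k_n}\to\alpha$ in probability as $n\to\infty$.
   Context: $\overline F\in\mathrm{RV}_{-\alpha}$ means $\lim_{t\to\infty}\overline F(tx)/\overline F(t)=x^{-\alpha}$ for every $x>0$. $X_{1:n}\le\dots\le X_{n:n}$ are the order statistics of $X_1,\dots,X_n$. For $1\le k\le n-1$, Hill's estimator is $$\widehat\alpha_{n,k}=H_{n,k}^{-1},\qquad H_{n,k}=\frac1k\sum_{i=1}^k\log\frac{X_{n-k+i:n}}{X_{n-k:n}}.$$ A random intermediate sequence is a sequence $(k_n)$ of random variables, with $k_n$ taking values in $\{1,\dots,n-1\}$ and defined on the same probability space as the data, such that $k_n\to\infty$ in probability and $k_n/n\to0$ in probability. In particular $k_n$ may be random and may depend on the data $X_1,\dots,X_n$ (arbitrary dependence is allowed). *)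

theory Defs
  imports "HOL-Probability.Probability"
begin

text \<open>Total division returns 0 where f vanishes. Since \<open>x powr \<rho> > 0\<close>, the limit at \<open>x = 1\<close> already
  forces f to be eventually nonzero.\<close>

definition regularly_varying :: "(real \<Rightarrow> real) \<Rightarrow> real \<Rightarrow> bool" where
  "regularly_varying f \<rho> \<longleftrightarrow> (\<forall>x>0. ((\<lambda>t. f (t * x) / f t) \<longlongrightarrow> x powr \<rho>) at_top)"

text \<open>Measurability is demanded explicitly, because \<open>measure\<close> returns 0 on non-measurable sets. It is
  demanded eventually, because the sequences of interest are only meaningful for \<open>n \<ge> 2\<close>.\<close>

definition tendsto_in_prob :: "'a measure \<Rightarrow> (nat \<Rightarrow> 'a \<Rightarrow> real) \<Rightarrow> real \<Rightarrow> bool" where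
  "tendsto_in_prob M Y c \<longleftrightarrow>
     (\<forall>\<^sub>F n in sequentially. Y n \<in> borel_measurable M) \<and>
     (\<forall>\<epsilon>>0. (\<lambda>n. measure M {\<omega> \<in> space M. \<bar>Y n \<omega> - c\<bar> > \<epsilon>}) \<longlonglongrightarrow> 0)"

definition tendsto_infinity_in_prob :: "'a measure \<Rightarrow> (nat \<Rightarrow> 'a \<Rightarrow> real) \<Rightarrow> bool" where
  "tendsto_infinity_in_prob M Y \<longleftrightarrow>
     (\<forall>\<^sub>F n in sequentially. Y n \<in> borel_measurable M) \<and>
     (\<forall>K. (\<lambda>n. measure M {\<omega> \<in> space M. Y n \<omega> > K}) \<longlonglongrightarrow> 1)"

text \<open>The range condition starts at \<open>n = 2\<close>, since \<open>{1..n - 1}\<close> is empty for \<open>n = 1\<close>. No relation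
  between the sequence and any data on M is imposed.\<close>

definition random_intermediate_sequence :: "'a measure \<Rightarrow> (nat \<Rightarrow> 'a \<Rightarrow> nat) \<Rightarrow> bool" where
  "random_intermediate_sequence M k \<longleftrightarrow>
     (\<forall>n\<ge>2. k n \<in> measurable M (count_space UNIV)) \<and>
     (\<forall>n\<ge>2. \<forall>\<omega>\<in>space M. k n \<omega> \<in> {1..n - 1}) \<and>
     tendsto_infinity_in_prob M (\<lambda>n \<omega>. real (k n \<omega>)) \<and>
     tendsto_in_prob M (\<lambda>n \<omega>. real (k n \<omega>) / real n) 0"

text \<open>The j-th smallest of \<open>x 1, \<dots>, x n\<close>, meaningful for \<open>1 \<le> j \<le> n\<close>; ranks start at 1, list
  positions at 0.\<close>

definition order_statistic :: "(nat \<Rightarrow> real) \<Rightarrow> nat \<Rightarrow> nat \<Rightarrow> real" where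
  "order_statistic x n j = sort (map x [1..<n + 1]) ! (j - 1)"

definition hill_H :: "(nat \<Rightarrow> real) \<Rightarrow> nat \<Rightarrow> nat \<Rightarrow> real" where
  "hill_H x n k =
     (1 / real k) * (\<Sum>i=1..k. ln (order_statistic x n (n - k + i) / order_statistic x n (n - k)))"

text \<open>\<open>inverse 0 = 0\<close> is a junk value; \<open>hill_H x n k = 0\<close> requires ties among the \<open>x i\<close> when these are
  positive, a null event for samples from a continuous distribution.\<close>

definition hill_estimator :: "(nat \<Rightarrow> real) \<Rightarrow> nat \<Rightarrow> nat \<Rightarrow> real" where
  "hill_estimator x n k = inverse (hill_H x n k)"

end

theory Submission
  imports Defs "HOL-Real_Asymp.Real_Asymp"
begin

text \<open>
  Since the random index \<open>k\<close> may depend on the data in any way, Hill's statistic has to be controlled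
  for all \<open>k\<close> in a range \<open>K \<le> k \<le> \<kappa> n\<close> simultaneously, outside one event of small probability
  (\<open>hill_H_uniformly_close\<close>). The theorem follows because a random intermediate sequence lies in
  every such range with probability tending to 1.

  The uniform statement is obtained from second moments alone. Write \<open>G\<close> for the tail of the
  distribution, \<open>N t\<close> for the number of observations above \<open>t\<close>, and \<open>S t\<close> for the sum of
  \<open>max 0 (ln (X i / t))\<close> over the sample. Then \<open>k * hill_H\<close> is exactly \<open>S\<close> evaluated at the order
  statistic of rank \<open>n - k\<close>, and \<open>S\<close> is decreasing. So if \<open>u\<close> is exceeded by more than
  \<open>k\<close> observations and \<open>s\<close> by at most \<open>k\<close>, then \<open>S s / k \<le> hill_H \<le> S u / k\<close>
  (\<open>hill_H_sandwich\<close>). This replaces the random threshold by deterministic ones.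

  Continuity of the distribution function provides deterministic thresholds \<open>T m\<close> with
  \<open>n * G (T m) = q ^ m\<close> for a ratio \<open>q\<close> slightly above 1. Regular variation gives
  \<open>E (S t) \<sim> n * G t / \<alpha>\<close> and a bound of order \<open>n * G t\<close> on the variance of \<open>S t\<close>
  (\<open>log_excess_moments\<close>); for \<open>N t\<close> the mean is \<open>n * G t\<close> and the variance at most that. By
  Chebyshev's inequality, the probability that \<open>N (T m)\<close> or \<open>S (T m)\<close> deviates from its mean by
  more than a fraction of \<open>q ^ m\<close> is of order \<open>q powr - m\<close>. These bounds form a convergent
  geometric series, hence the union over all \<open>m \<ge> m0\<close> is improbable for large \<open>m0\<close>. Outside
  it, an index \<open>k\<close> between \<open>q ^ m\<close> and \<open>q ^ (m + 1)\<close> is sandwiched by the thresholds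
  \<open>T (m - 1)\<close> and \<open>T (m + 2)\<close>, which costs only a factor \<open>q\<^sup>2\<close> on either side.
\<close>

section \<open>Hill's statistic as a decreasing function of the threshold\<close>

text \<open>The positive part of \<open>ln (x / t)\<close>, for \<open>t > 0\<close>; the case distinction makes it vanish at
  \<open>x \<le> 0\<close> whatever value the logarithm has there.\<close>

definition log_excess :: "real \<Rightarrow> real \<Rightarrow> real" where
  "log_excess t x = (if x > t then ln (x / t) else 0)"

lemma log_excess_nonneg: "t > 0 \<Longrightarrow> log_excess t x \<ge> 0"
  by (simp add: log_excess_def)

lemma log_excess_antimono:
  assumes "0 < s" "s \<le> t"
  shows "log_excess t x \<le> log_excess s x"
  using assms by (auto simp: log_excess_def intro!: divide_left_mono)

lemma log_excess_measurable [measurable]: "log_excess t \<in> borel_measurable borel"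
  unfolding log_excess_def by measurable

text \<open>Translates positions in the sorted sample into exceedance counts, which as sums of indicators of
  the observations are measurable and accessible to Chebyshev's inequality.\<close>

lemma order_statistic_greater_iff:
  assumes "1 \<le> j" "j \<le> n"
  shows "c < order_statistic x n j \<longleftrightarrow> n - j < card {i \<in> {1..n}. c < x i}"
proof -
  define ys where "ys = sort (map x [1..<n + 1])"
  have len: "length ys = n" and srt: "sorted ys"
    by (simp_all add: ys_def)
  have "card {i \<in> {1..n}. c < x i} = length (filter (\<lambda>i. c < x i) [1..<n + 1])"
    by (subst distinct_card [symmetric]) (auto intro!: arg_cong [of _ _ card])
  also have "\<dots> = length (filter (\<lambda>y. c < y) (map x [1..<n + 1]))"
    by (simp add: filter_map o_def)
  also have "\<dots> = length (filter (\<lambda>y. c < y) ys)"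
    unfolding ys_def by (metis mset_filter mset_sort size_mset)
  also have "\<dots> = card {p. p < n \<and> c < ys ! p}"
    by (simp add: length_filter_conv_card len)
  finally have eq: "card {i \<in> {1..n}. c < x i} = card {p. p < n \<and> c < ys ! p}" .
  have mono: "ys ! p \<le> ys ! r" if "p \<le> r" "r < n" for p r
    using sorted_nth_mono [OF srt] that len by blast
  show ?thesis
  proof
    assume "c < order_statistic x n j"
    then have "c < ys ! (j - 1)"
      by (simp add: order_statistic_def ys_def)
    then have "{j - 1..<n} \<subseteq> {p. p < n \<and> c < ys ! p}"
      using mono by (fastforce intro: less_le_trans)
    then have "card {j - 1..<n} \<le> card {p. p < n \<and> c < ys ! p}"
      by (intro card_mono) auto
    then show "n - j < card {i \<in> {1..n}. c < x i}"
      using eq assms by simp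
  next
    assume *: "n - j < card {i \<in> {1..n}. c < x i}"
    show "c < order_statistic x n j"
    proof (rule ccontr)
      assume "\<not> ?thesis"
      then have "ys ! (j - 1) \<le> c"
        by (simp add: order_statistic_def ys_def)
      then have "p \<ge> j" if "p < n" "c < ys ! p" for p
        using mono [of p "j - 1"] that assms by force
      then have "{p. p < n \<and> c < ys ! p} \<subseteq> {j..<n}"
        by auto
      then have "card {p. p < n \<and> c < ys ! p} \<le> card {j..<n}"
        by (intro card_mono) auto
      then show False
        using * eq by simp
    qed
  qed
qed

text \<open>Observations of rank at most \<open>n - k\<close> do not exceed the threshold and contribute nothing, so the
  sum over the top \<open>k\<close> ranks may be taken over the whole, unordered sample. Ties are harmless: an
  observation equal to the threshold has logarithmic excess 0 on both sides.\<close>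

lemma hill_H_eq_log_excess_sum:
  assumes "1 \<le> k" "k < n" and pos: "order_statistic x n (n - k) > 0"
  shows "hill_H x n k = (\<Sum>i=1..n. log_excess (order_statistic x n (n - k)) (x i)) / real k"
proof -
  define ys where "ys = sort (map x [1..<n + 1])"
  define T where "T = order_statistic x n (n - k)"
  have len: "length ys = n" and srt: "sorted ys"
    by (simp_all add: ys_def)
  have mono: "ys ! p \<le> ys ! r" if "p \<le> r" "r < n" for p r
    using sorted_nth_mono [OF srt] that len by blast
  have T: "T = ys ! (n - k - 1)" "T > 0"
    using pos by (simp_all add: T_def order_statistic_def ys_def)
  have "(\<Sum>i=1..n. log_excess T (x i)) = sum_list (map (log_excess T) (map x [1..<n + 1]))"
    by (simp add: sum_list_distinct_conv_sum_set o_def atLeastLessThanSuc_atLeastAtMost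
             del: upt_Suc)
  also have "\<dots> = sum_list (map (log_excess T) ys)"
    unfolding ys_def by (metis mset_map mset_sort sum_mset_sum_list)
  also have "\<dots> = (\<Sum>p=0..<n. log_excess T (ys ! p))"
    by (simp add: sum_list_sum_nth len)
  also have "\<dots> = (\<Sum>p=n - k..<n. log_excess T (ys ! p))"
  proof (rule sum.mono_neutral_right)
    show "\<forall>p\<in>{0..<n} - {n - k..<n}. log_excess T (ys ! p) = 0"
      using mono [of _ "n - k - 1"] T assms by (auto simp: log_excess_def not_less)
  qed auto
  also have "\<dots> = (\<Sum>p=n - k..<n. ln (ys ! p / T))"
  proof (rule sum.cong)
    fix p assume "p \<in> {n - k..<n}"
    then have "n - k - 1 \<le> p" "p < n"
      by auto
    then have "T \<le> ys ! p"
      using mono T(1) by blast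
    then show "log_excess T (ys ! p) = ln (ys ! p / T)"
      using T(2) by (cases "T = ys ! p") (auto simp: log_excess_def)
  qed simp
  also have "\<dots> = (\<Sum>i=1..k. ln (ys ! (n - k + i - 1) / T))"
    by (rule sum.reindex_bij_witness [of _ "\<lambda>i. n - k + i - 1" "\<lambda>p. p + 1 - (n - k)"])
       (use assms in auto)
  finally show ?thesis
    by (simp add: hill_H_def order_statistic_def ys_def T_def)
qed

text \<open>The exceedance counts say that the order statistic of rank \<open>n - k\<close> lies in \<open>{u<..s}\<close>; monotonicity
  in the threshold does the rest.\<close>

lemma hill_H_sandwich:
  assumes k: "1 \<le> k" "k < n" and "0 < u"
    and s: "card {i \<in> {1..n}. s < x i} \<le> k" and u: "k < card {i \<in> {1..n}. u < x i}"
  shows "(\<Sum>i=1..n. log_excess s (x i)) / real k \<le> hill_H x n k"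
    and "hill_H x n k \<le> (\<Sum>i=1..n. log_excess u (x i)) / real k"
proof -
  define T where "T = order_statistic x n (n - k)"
  have "T \<le> s" and uT: "u < T"
    using order_statistic_greater_iff [of "n - k" n s x] order_statistic_greater_iff [of "n - k" n u x]
      k s u by (auto simp: T_def not_less)
  have "T > 0" using uT \<open>0 < u\<close> by simp
  note eq = hill_H_eq_log_excess_sum [OF k, of x, folded T_def, OF \<open>T > 0\<close>]
  show "(\<Sum>i=1..n. log_excess s (x i)) / real k \<le> hill_H x n k"
    unfolding eq using \<open>T > 0\<close> \<open>T \<le> s\<close>
    by (intro divide_right_mono sum_mono log_excess_antimono) auto
  show "hill_H x n k \<le> (\<Sum>i=1..n. log_excess u (x i)) / real k"
    unfolding eq using \<open>0 < u\<close> uT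
    by (intro divide_right_mono sum_mono log_excess_antimono) auto
qed

section \<open>Measurability of the estimator\<close>

lemma order_statistic_measurable:
  assumes "\<And>i. i \<in> {1..n} \<Longrightarrow> X i \<in> borel_measurable M" and "1 \<le> j" "j \<le> n"
  shows "(\<lambda>\<omega>. order_statistic (\<lambda>i. X i \<omega>) n j) \<in> borel_measurable M"
proof (rule borel_measurableI_greater)
  fix c :: real
  have *: "real (card {i \<in> {1..n}. c < X i \<omega>}) = (\<Sum>i=1..n. indicator {c<..} (X i \<omega>))" for \<omega>
    by (simp add: indicator_def sum.If_cases Int_def flip: sum.inter_filter)
  have [measurable]: "(\<lambda>\<omega>. real (card {i \<in> {1..n}. c < X i \<omega>})) \<in> borel_measurable M"
    unfolding * using assms(1) by measurable
  have "{\<omega> \<in> space M. c < order_statistic (\<lambda>i. X i \<omega>) n j}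
      = {\<omega> \<in> space M. real (n - j) < real (card {i \<in> {1..n}. c < X i \<omega>})}"
    using order_statistic_greater_iff [OF assms(2,3)] by simp
  also have "\<dots> \<in> sets M" by measurable
  finally show "{\<omega> \<in> space M. c < order_statistic (\<lambda>i. X i \<omega>) n j} \<in> sets M" .
qed

lemma hill_estimator_measurable:
  assumes X: "\<And>i. i \<in> {1..n} \<Longrightarrow> X i \<in> borel_measurable M"
    and k: "k \<in> measurable M (count_space UNIV)" "\<And>\<omega>. \<omega> \<in> space M \<Longrightarrow> k \<omega> \<in> {1..n - 1}"
  shows "(\<lambda>\<omega>. hill_estimator (\<lambda>i. X i \<omega>) n (k \<omega>)) \<in> borel_measurable M"
proof -
  have [measurable]: "(\<lambda>\<omega>. hill_estimator (\<lambda>i. X i \<omega>) n l) \<in> borel_measurable M"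
    if "l \<in> {1..n - 1}" for l
    unfolding hill_estimator_def hill_H_def using that
    by (intro borel_measurable_inverse borel_measurable_times borel_measurable_sum borel_measurable_const
        measurable_compose [OF _ borel_measurable_ln] borel_measurable_ln borel_measurable_divide
        order_statistic_measurable X) auto
  note k(1) [measurable]
  have "(\<lambda>\<omega>. \<Sum>l\<in>{1..n - 1}. if k \<omega> = l then hill_estimator (\<lambda>i. X i \<omega>) n l else 0)
      \<in> borel_measurable M"
    by measurable
  also have "?this \<longleftrightarrow> ?thesis"
    using k(2) by (intro measurable_cong) (simp add: sum.delta)
  finally show ?thesis .
qed

section \<open>Deviations of sums of i.i.d. variables\<close>

lemma (in prob_space) indep_centered_sum_second_moment:
  fixes Y :: "'i \<Rightarrow> 'a \<Rightarrow> real"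
  assumes "finite I" and "indep_vars (\<lambda>_. borel) Y I"
    and "\<And>i. i \<in> I \<Longrightarrow> integrable M (\<lambda>\<omega>. (Y i \<omega>)\<^sup>2)"
    and "\<And>i. i \<in> I \<Longrightarrow> expectation (Y i) = 0"
  shows "integrable M (\<lambda>\<omega>. (\<Sum>i\<in>I. Y i \<omega>)\<^sup>2)
    \<and> expectation (\<lambda>\<omega>. (\<Sum>i\<in>I. Y i \<omega>)\<^sup>2) = (\<Sum>i\<in>I. expectation (\<lambda>\<omega>. (Y i \<omega>)\<^sup>2))"
  using assms
proof (induction I rule: finite_induct)
  case empty
  then show ?case by simp
next
  case (insert i I)
  let ?S = "\<lambda>\<omega>. \<Sum>j\<in>I. Y j \<omega>"
  have rv: "j \<in> insert i I \<Longrightarrow> random_variable borel (Y j)" for j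
    using insert.prems(1) by (auto simp: indep_vars_def)
  have intY: "j \<in> insert i I \<Longrightarrow> integrable M (Y j)" for j
    using square_integrable_imp_integrable [OF rv insert.prems(2)] by simp
  have IH: "integrable M (\<lambda>\<omega>. (?S \<omega>)\<^sup>2)"
      "expectation (\<lambda>\<omega>. (?S \<omega>)\<^sup>2) = (\<Sum>j\<in>I. expectation (\<lambda>\<omega>. (Y j \<omega>)\<^sup>2))"
    using insert.IH [OF indep_vars_subset [OF insert.prems(1)]] insert.prems by auto
  have ind: "indep_var borel (Y i) borel ?S"
    using insert.hyps insert.prems(1) by (rule indep_vars_sum)
  have intS: "integrable M ?S"
    using intY by auto
  have cross: "integrable M (\<lambda>\<omega>. Y i \<omega> * ?S \<omega>)" "expectation (\<lambda>\<omega>. Y i \<omega> * ?S \<omega>) = 0"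
    using indep_var_integrable [OF ind intY intS] indep_var_lebesgue_integral [OF ind intY intS]
      insert.prems(3) by auto
  have sq: "(\<Sum>j\<in>insert i I. Y j \<omega>)\<^sup>2 = (Y i \<omega>)\<^sup>2 + 2 * (Y i \<omega> * ?S \<omega>) + (?S \<omega>)\<^sup>2" for \<omega>
    using insert.hyps by (simp add: power2_sum algebra_simps)
  show ?case
    unfolding sq using insert cross IH by simp
qed

text \<open>Chebyshev's inequality with the variance bounded by the second moment, in terms of integrals with
  respect to the common law only.\<close>

lemma (in prob_space) iid_sum_deviation:
  fixes X :: "nat \<Rightarrow> 'a \<Rightarrow> real" and g :: "real \<Rightarrow> real"
  assumes indep: "indep_vars (\<lambda>_. borel) X {1..}"
    and distr: "\<And>i. i \<ge> 1 \<Longrightarrow> distr M borel (X i) = D"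
    and g [measurable]: "g \<in> borel_measurable borel" and sq: "integrable D (\<lambda>x. (g x)\<^sup>2)"
    and "a > 0"
  shows "prob {\<omega> \<in> space M. a \<le> \<bar>(\<Sum>i=1..n. g (X i \<omega>)) - real n * (\<integral>x. g x \<partial>D)\<bar>}
    \<le> real n * (\<integral>x. (g x)\<^sup>2 \<partial>D) / a\<^sup>2"
proof -
  define \<mu> where "\<mu> = (\<integral>x. g x \<partial>D)"
  define Y where "Y i \<omega> = g (X i \<omega>) - \<mu>" for i \<omega>
  have rv: "i \<ge> 1 \<Longrightarrow> random_variable borel (X i)" for i
    using indep by (auto simp: indep_vars_def)
  have D: "prob_space D" "sets D = sets borel"
    using distr [of 1] prob_space_distr [OF rv [of 1]] by auto
  have gD [measurable]: "g \<in> borel_measurable D"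
    using g measurable_cong_sets [OF D(2) refl] by blast
  have int1: "integrable D g"
    using finite_measure.square_integrable_imp_integrable [OF prob_space.finite_measure [OF D(1)] gD sq] .
  have centre: "(\<integral>x. (g x - \<mu>)\<^sup>2 \<partial>D) = (\<integral>x. (g x)\<^sup>2 \<partial>D) - \<mu>\<^sup>2"
    using prob_space.variance_eq [OF D(1) int1 sq] by (simp add: \<mu>_def)
  have intsq: "integrable D (\<lambda>x. (g x - \<mu>)\<^sup>2)"
    using int1 sq prob_space.finite_measure [OF D(1)]
    by (simp add: power2_diff finite_measure.integrable_const)
  have transfer: "integrable M (\<lambda>\<omega>. h (X i \<omega>)) \<longleftrightarrow> integrable D h"
      "expectation (\<lambda>\<omega>. h (X i \<omega>)) = (\<integral>x. h x \<partial>D)"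
    if "i \<ge> 1" "h \<in> borel_measurable borel" for i and h :: "real \<Rightarrow> real"
    using integrable_distr_eq [OF rv that(2)] integral_distr [OF rv that(2)] that(1) distr by auto
  have "indep_vars (\<lambda>_. borel) Y {1..n}"
    unfolding Y_def by (rule indep_vars_compose2 [OF indep_vars_subset [OF indep]]) auto
  moreover have "integrable M (\<lambda>\<omega>. (Y i \<omega>)\<^sup>2)" "expectation (\<lambda>\<omega>. (Y i \<omega>)\<^sup>2) = (\<integral>x. (g x)\<^sup>2 \<partial>D) - \<mu>\<^sup>2"
      "expectation (Y i) = 0" if "i \<in> {1..n}" for i
    using transfer [of i "\<lambda>x. (g x - \<mu>)\<^sup>2"] transfer [of i "\<lambda>x. g x - \<mu>"] that intsq centre int1
      prob_space.prob_space [OF D(1)] prob_space.finite_measure [OF D(1)]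
    by (auto simp: Y_def [abs_def] finite_measure.integrable_const simp flip: \<mu>_def)
  ultimately have S: "integrable M (\<lambda>\<omega>. (\<Sum>i=1..n. Y i \<omega>)\<^sup>2)"
      "expectation (\<lambda>\<omega>. (\<Sum>i=1..n. Y i \<omega>)\<^sup>2) = real n * ((\<integral>x. (g x)\<^sup>2 \<partial>D) - \<mu>\<^sup>2)"
    using indep_centered_sum_second_moment [of "{1..n}" Y] by auto
  have "random_variable borel (Y i)" if "i \<in> {1..n}" for i
    unfolding Y_def using that rv by (intro borel_measurable_diff measurable_compose [OF _ g]) auto
  then have "prob {\<omega> \<in> space M. a \<le> \<bar>\<Sum>i=1..n. Y i \<omega>\<bar>}
      \<le> expectation (\<lambda>\<omega>. (\<Sum>i=1..n. Y i \<omega>)\<^sup>2) / a\<^sup>2"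
    using S(1) \<open>a > 0\<close> by (intro second_moment_method) auto
  also have "\<dots> \<le> real n * (\<integral>x. (g x)\<^sup>2 \<partial>D) / a\<^sup>2"
    unfolding S(2) by (intro divide_right_mono mult_left_mono) auto
  finally show ?thesis
    by (simp add: Y_def sum_subtractf \<mu>_def)
qed

section \<open>Moments from tails at integer levels\<close>

text \<open>Integration of the pointwise bound \<open>\<phi> (Z x) \<le> \<Sum> w j\<close>, the sum being over the integers
  \<open>j < Z x\<close>. Constant weights 1 give the first moment, weights \<open>2 * j + 1\<close> the second.\<close>

lemma (in finite_measure) integral_le_weighted_tail_sum:
  fixes Z :: "'a \<Rightarrow> real"
  assumes Z [measurable]: "Z \<in> borel_measurable M" and Z_nonneg: "\<And>x. Z x \<ge> 0"
    and \<phi> [measurable]: "\<phi> \<in> borel_measurable borel"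
    and \<phi>: "\<And>z. z \<ge> 0 \<Longrightarrow> 0 \<le> \<phi> z \<and> \<phi> z \<le> (\<Sum>j<nat \<lceil>z\<rceil>. w j)"
    and w: "\<And>j. w j \<ge> 0"
    and b: "\<And>j. measure M {x \<in> space M. Z x > real j} \<le> b j" and summable: "summable (\<lambda>j. w j * b j)"
  shows "integrable M (\<lambda>x. \<phi> (Z x))" and "(\<integral>x. \<phi> (Z x) \<partial>M) \<le> (\<Sum>j. w j * b j)"
proof -
  have b_nonneg: "b j \<ge> 0" for j
    using b [of j] measure_nonneg order_trans by blast
  have le: "ennreal (\<phi> (Z x)) \<le> (\<Sum>j. ennreal (w j) * indicator {x \<in> space M. Z x > real j} x)"
    if "x \<in> space M" for x
  proof -
    have "j < nat \<lceil>Z x\<rceil> \<Longrightarrow> Z x > real j" for j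
      by linarith
    then have "(\<Sum>j<nat \<lceil>Z x\<rceil>. ennreal (w j) * indicator {x \<in> space M. Z x > real j} x)
        = (\<Sum>j<nat \<lceil>Z x\<rceil>. ennreal (w j))"
      using that by (intro sum.cong) auto
    also have "\<dots> = ennreal (\<Sum>j<nat \<lceil>Z x\<rceil>. w j)"
      using w by (simp add: sum_ennreal)
    finally have "ennreal (\<phi> (Z x))
        \<le> (\<Sum>j<nat \<lceil>Z x\<rceil>. ennreal (w j) * indicator {x \<in> space M. Z x > real j} x)"
      using \<phi> [OF Z_nonneg] by (simp add: ennreal_leI)
    also have "\<dots> \<le> (\<Sum>j. ennreal (w j) * indicator {x \<in> space M. Z x > real j} x)"
      by (intro sum_le_suminf) auto
    finally show ?thesis .
  qed
  have "(\<integral>\<^sup>+x. ennreal (\<phi> (Z x)) \<partial>M)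
      \<le> (\<integral>\<^sup>+x. (\<Sum>j. ennreal (w j) * indicator {x \<in> space M. Z x > real j} x) \<partial>M)"
    by (intro nn_integral_mono le)
  also have "\<dots> = (\<Sum>j. ennreal (w j) * emeasure M {x \<in> space M. Z x > real j})"
    by (subst nn_integral_suminf) (auto simp: nn_integral_cmult_indicator)
  also have "\<dots> \<le> (\<Sum>j. ennreal (w j * b j))"
    using b by (intro suminf_le) (auto simp: emeasure_eq_measure ennreal_mult w b_nonneg intro!: mult_left_mono ennreal_leI)
  also have "\<dots> = ennreal (\<Sum>j. w j * b j)"
    using w b_nonneg summable by (intro suminf_ennreal2) auto
  finally have *: "(\<integral>\<^sup>+x. ennreal (\<phi> (Z x)) \<partial>M) \<le> ennreal (\<Sum>j. w j * b j)" .
  show "integrable M (\<lambda>x. \<phi> (Z x))"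
    using \<phi> Z_nonneg * by (intro integrableI_nonneg) (auto intro: le_less_trans)
  show "(\<integral>x. \<phi> (Z x) \<partial>M) \<le> (\<Sum>j. w j * b j)"
    using * w b_nonneg by (intro integral_real_bounded suminf_nonneg summable) auto
qed

text \<open>The matching lower bound: the number of positive integers below \<open>Z x\<close> is at most \<open>Z x\<close>.\<close>

lemma (in finite_measure) tail_sum_le_integral:
  fixes Z :: "'a \<Rightarrow> real"
  assumes int: "integrable M Z" and Z_nonneg: "\<And>x. Z x \<ge> 0"
    and b: "\<And>j. b j \<le> measure M {x \<in> space M. Z x > real (Suc j)}" and summable: "summable b"
  shows "(\<Sum>j. b j) \<le> (\<integral>x. Z x \<partial>M)"
proof (rule suminf_le_const [OF summable])
  fix N
  note [measurable] = borel_measurable_integrable [OF int]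
  let ?A = "\<lambda>j. {x \<in> space M. Z x > real (Suc j)}"
  have "(\<Sum>j<N. b j) \<le> (\<Sum>j<N. measure M (?A j))"
    by (intro sum_mono b)
  also have "\<dots> = (\<integral>x. (\<Sum>j<N. indicator (?A j) x) \<partial>M)"
    by (subst Bochner_Integration.integral_sum)
       (auto simp: emeasure_eq_measure intro!: sum.cong arg_cong [of _ _ "measure M"])
  also have "\<dots> \<le> (\<integral>x. Z x \<partial>M)"
  proof (intro integral_mono int)
    fix x assume x: "x \<in> space M"
    have "(\<Sum>j<N. indicator (?A j) x :: real) = real (card {j. j < N \<and> real (Suc j) < Z x})"
      using x by (simp add: indicator_def sum.If_cases Int_def)
    also have "\<dots> \<le> real (card {..<nat \<lfloor>Z x\<rfloor>})"
      by (intro of_nat_mono card_mono) (auto, linarith)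
    also have "\<dots> \<le> Z x"
      using Z_nonneg [of x] by simp
    finally show "(\<Sum>j<N. indicator (?A j) x) \<le> Z x" .
  qed (auto simp: emeasure_eq_measure)
  finally show "(\<Sum>j<N. b j) \<le> (\<integral>x. Z x \<partial>M)" .
qed

section \<open>Logarithmic excesses under a regularly varying tail\<close>

text \<open>A form of Potter's bounds. The ratio \<open>G (t * r) / G t\<close> is near its limit from some \<open>t\<close>
  onwards; since \<open>t * r ^ j \<ge> t\<close>, that one estimate can be iterated, which makes the bounds uniform
  in \<open>j\<close>.\<close>

lemma regularly_varying_geometric_bounds:
  assumes rv: "regularly_varying G \<rho>" and "r > 1" and lo: "l < r powr \<rho>" "0 \<le> l" and hi: "r powr \<rho> < u"
    and pos: "\<And>t. G t > 0"
  shows "\<forall>\<^sub>F t in at_top. \<forall>j. l ^ j * G t \<le> G (t * r ^ j) \<and> G (t * r ^ j) \<le> u ^ j * G t"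
proof -
  have "((\<lambda>t. G (t * r) / G t) \<longlongrightarrow> r powr \<rho>) at_top"
    using rv \<open>r > 1\<close> by (simp add: regularly_varying_def)
  then have "\<forall>\<^sub>F t in at_top. l < G (t * r) / G t" "\<forall>\<^sub>F t in at_top. G (t * r) / G t < u"
    using lo hi by (simp_all add: order_tendsto_iff)
  then have "\<forall>\<^sub>F t in at_top. l * G t \<le> G (t * r) \<and> G (t * r) \<le> u * G t"
  proof eventually_elim
    case (elim t)
    then show ?case
      using pos [of t] by (simp add: field_simps)
  qed
  then obtain t0 where t0: "\<And>t. t \<ge> t0 \<Longrightarrow> l * G t \<le> G (t * r) \<and> G (t * r) \<le> u * G t"
    by (auto simp: eventually_at_top_linorder)
  have "u \<ge> 0"
    using hi by (meson less_le_trans less_imp_le powr_ge_zero le_less_trans)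
  have "l ^ j * G t \<le> G (t * r ^ j) \<and> G (t * r ^ j) \<le> u ^ j * G t" if "t \<ge> max 1 t0" for t j
  proof (induction j)
    case (Suc j)
    have "t \<le> t * r ^ j"
      using that \<open>r > 1\<close> by (simp add: mult_le_cancel_left1)
    then have "t0 \<le> t * r ^ j"
      using that by linarith
    then have step: "l * G (t * r ^ j) \<le> G (t * r ^ Suc j)" "G (t * r ^ Suc j) \<le> u * G (t * r ^ j)"
      using t0 [of "t * r ^ j"] by (simp_all add: mult_ac)
    have "l * (l ^ j * G t) \<le> l * G (t * r ^ j)" "u * G (t * r ^ j) \<le> u * (u ^ j * G t)"
      using Suc lo \<open>u \<ge> 0\<close> by (auto intro: mult_left_mono)
    then show ?case
      using step by (simp add: mult_ac)
  qed simp
  then show ?thesis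
    unfolding eventually_at_top_linorder by blast
qed

text \<open>In \<open>log_excess_moments\<close> the mean excess is squeezed between two geometric series whose common ratio
  is near \<open>p = r powr - \<alpha>\<close>. Both \<open>ln r * p / (1 - p)\<close> and \<open>ln r / (1 - p)\<close> tend to \<open>1 / \<alpha>\<close>
  as \<open>r\<close> decreases to 1, so \<open>r\<close> is fixed first and then the ratios \<open>l < p < u\<close> are taken close
  enough to \<open>p\<close>.\<close>

lemma geometric_ratio_bounds:
  fixes \<alpha> \<epsilon> :: real
  assumes "\<alpha> > 0" "\<epsilon> > 0"
  obtains r l u where "r > 1" "0 \<le> l" "l < r powr - \<alpha>" "r powr - \<alpha> < u" "u < 1"
    "1 / \<alpha> - \<epsilon> \<le> ln r * (l / (1 - l))" "ln r * (1 / (1 - u)) \<le> 1 / \<alpha> + \<epsilon>"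
proof -
  have "((\<lambda>r. ln r * (r powr - \<alpha> / (1 - r powr - \<alpha>))) \<longlongrightarrow> inverse \<alpha>) (at_right 1)"
       "((\<lambda>r. ln r * (1 / (1 - r powr - \<alpha>))) \<longlongrightarrow> inverse \<alpha>) (at_right 1)"
    using assms(1) by real_asymp+
  note lim = this [unfolded inverse_eq_divide]
  have "\<forall>\<^sub>F r in at_right 1. 1 / \<alpha> - \<epsilon> < ln r * (r powr - \<alpha> / (1 - r powr - \<alpha>))"
    by (rule order_tendstoD(1) [OF lim(1)]) (use assms(2) in simp)
  moreover have "\<forall>\<^sub>F r in at_right 1. ln r * (1 / (1 - r powr - \<alpha>)) < 1 / \<alpha> + \<epsilon>"
    by (rule order_tendstoD(2) [OF lim(2)]) (use assms(2) in simp)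
  moreover have "\<forall>\<^sub>F r :: real in at_right 1. r > 1"
    by (rule eventually_at_right_less)
  ultimately have "\<forall>\<^sub>F r in at_right 1. r > 1 \<and> 1 / \<alpha> - \<epsilon> < ln r * (r powr - \<alpha> / (1 - r powr - \<alpha>))
      \<and> ln r * (1 / (1 - r powr - \<alpha>)) < 1 / \<alpha> + \<epsilon>"
    by eventually_elim auto
  then obtain r where r: "r > 1" "1 / \<alpha> - \<epsilon> < ln r * (r powr - \<alpha> / (1 - r powr - \<alpha>))"
      "ln r * (1 / (1 - r powr - \<alpha>)) < 1 / \<alpha> + \<epsilon>"
    using eventually_happens' [OF trivial_limit_at_right_real] by blast
  define p where "p = r powr - \<alpha>"
  have p: "0 < p" "p < 1"
    using r(1) assms(1) by (auto simp: p_def powr_less_one)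
  have "((\<lambda>x. ln r * (x / (1 - x))) \<longlongrightarrow> ln r * (p / (1 - p))) (at_left p)"
    using p by (auto intro!: tendsto_eq_intros)
  then have "\<forall>\<^sub>F x in at_left p. 1 / \<alpha> - \<epsilon> < ln r * (x / (1 - x))"
    by (rule order_tendstoD) (use r(2) in \<open>simp add: p_def\<close>)
  from eventually_conj [OF this eventually_at_left_real [OF p(1)]]
  obtain l where l: "1 / \<alpha> - \<epsilon> < ln r * (l / (1 - l))" "l \<in> {0<..<p}"
    using eventually_happens' [OF trivial_limit_at_left_real] by blast
  have "((\<lambda>x. ln r * (1 / (1 - x))) \<longlongrightarrow> ln r * (1 / (1 - p))) (at_right p)"
    using p by (auto intro!: tendsto_eq_intros)
  then have "\<forall>\<^sub>F x in at_right p. ln r * (1 / (1 - x)) < 1 / \<alpha> + \<epsilon>"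
    by (rule order_tendstoD) (use r(3) in \<open>simp add: p_def\<close>)
  from eventually_conj [OF this eventually_at_right_real [OF p(2)]]
  obtain u where u: "ln r * (1 / (1 - u)) < 1 / \<alpha> + \<epsilon>" "u \<in> {p<..<1}"
    using eventually_happens' [OF trivial_limit_at_right_real] by blast
  show thesis
    by (rule that [of r l u]) (use r(1) l u in \<open>auto simp: p_def\<close>)
qed

text \<open>Measured in units of \<open>ln r\<close>, the excess of \<open>x\<close> over \<open>t\<close> is greater than \<open>j\<close> exactly when
  \<open>x > t * r ^ j\<close>, so its tails at integer levels are \<open>G (t * r ^ j)\<close>, which lie between multiples
  of \<open>l ^ j\<close> and \<open>u ^ j\<close>. Summation of these tails gives both moments. The estimate of the mean is
  Karamata's theorem for \<open>\<integral> G x / x dx\<close> over \<open>{t..}\<close>.\<close>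

lemma log_excess_moments:
  fixes D :: "real measure" and \<alpha> \<epsilon> :: real
  defines "G \<equiv> \<lambda>t. measure D {t<..}"
  assumes D: "real_distribution D" and \<alpha>: "\<alpha> > 0" and rv: "regularly_varying G (- \<alpha>)"
    and pos: "\<And>t. G t > 0" and \<epsilon>: "\<epsilon> > 0"
  obtains C where "C > 0" "\<forall>\<^sub>F t in at_top. integrable D (\<lambda>x. (log_excess t x)\<^sup>2)
    \<and> \<bar>(\<integral>x. log_excess t x \<partial>D) - G t / \<alpha>\<bar> \<le> \<epsilon> * G t
    \<and> (\<integral>x. (log_excess t x)\<^sup>2 \<partial>D) \<le> C * G t"
proof -
  interpret real_distribution D by fact
  obtain r l u where r: "r > 1" and lu: "0 \<le> l" "l < r powr - \<alpha>" "r powr - \<alpha> < u" "u < 1"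
    and lo: "1 / \<alpha> - \<epsilon> \<le> ln r * (l / (1 - l))" and hi: "ln r * (1 / (1 - u)) \<le> 1 / \<alpha> + \<epsilon>"
    using geometric_ratio_bounds [OF \<alpha> \<epsilon>] by metis
  have "ln r > 0" "l < 1" "0 < u"
    using r lu by (auto intro: le_less_trans)
  define w :: "nat \<Rightarrow> real" where "w j = 2 * real j + 1" for j
  have sum_w: "(\<Sum>j<n. w j) = (real n)\<^sup>2" for n
    by (induction n) (simp_all add: w_def power2_eq_square algebra_simps)
  \<comment> \<open>Here \<open>diffs\<close> supplies the coefficients \<open>j + 1\<close> of the derivative of the geometric series, and
    \<open>w j = 2 * (j + 1) - 1\<close>.\<close>
  have "summable (\<lambda>j. diffs (\<lambda>_. 1) j * u ^ j)"
    using lu \<open>0 < u\<close> by (intro termdiff_converges [of u 1]) (auto intro: summable_geometric)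
  then have "summable (\<lambda>j. 2 * (diffs (\<lambda>_. 1) j * u ^ j) - u ^ j)"
    using lu \<open>0 < u\<close> by (intro summable_diff summable_mult summable_geometric) auto
  also have "(\<lambda>j. 2 * (diffs (\<lambda>_. 1) j * u ^ j) - u ^ j) = (\<lambda>j. w j * u ^ j)"
    by (auto simp: diffs_def w_def algebra_simps)
  finally have summable_w: "summable (\<lambda>j. w j * u ^ j)" .
  define C where "C = (ln r)\<^sup>2 * (\<Sum>j. w j * u ^ j)"
  have "(\<Sum>j. w j * u ^ j) > 0"
    using \<open>0 < u\<close> by (intro suminf_pos summable_w) (simp add: w_def)
  then have "C > 0"
    using \<open>ln r > 0\<close> by (simp add: C_def)
  have "\<forall>\<^sub>F t in at_top. \<forall>j. l ^ j * G t \<le> G (t * r ^ j) \<and> G (t * r ^ j) \<le> u ^ j * G t"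
    using rv r lu pos by (intro regularly_varying_geometric_bounds)
  moreover have "\<forall>\<^sub>F t in at_top. t > (0::real)"
    by (rule eventually_gt_at_top)
  ultimately have "\<forall>\<^sub>F t in at_top. integrable D (\<lambda>x. (log_excess t x)\<^sup>2)
    \<and> \<bar>(\<integral>x. log_excess t x \<partial>D) - G t / \<alpha>\<bar> \<le> \<epsilon> * G t
    \<and> (\<integral>x. (log_excess t x)\<^sup>2 \<partial>D) \<le> C * G t"
  proof eventually_elim
    case (elim t)
    define Z where "Z x = log_excess t x / ln r" for x
    have eq: "log_excess t x = ln r * Z x" for x
      using \<open>ln r > 0\<close> by (simp add: Z_def)
    have Zm [measurable]: "Z \<in> borel_measurable D"
      unfolding Z_def by measurable
    have Z0: "Z x \<ge> 0" for x
      using log_excess_nonneg elim \<open>ln r > 0\<close> by (simp add: Z_def)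
    have level: "{x \<in> space D. Z x > real j} = {t * r ^ j<..}" for j
    proof -
      have "Z x > real j \<longleftrightarrow> t * r ^ j < x" for x
      proof (cases "x > t")
        case True
        have "Z x > real j \<longleftrightarrow> ln (r ^ j) < ln (x / t)"
          using True \<open>ln r > 0\<close> r by (simp add: Z_def log_excess_def ln_realpow field_simps)
        also have "\<dots> \<longleftrightarrow> r ^ j < x / t"
          using True elim r by (intro ln_less_cancel_iff) auto
        finally show ?thesis
          using elim by (simp add: field_simps)
      next
        case False
        have "t \<le> t * r ^ j"
          using elim r by (simp add: mult_le_cancel_left1)
        then show ?thesis
          using False by (auto simp: Z_def log_excess_def)
      qed
      then show ?thesis by auto
    qed
    have tail: "measure D {x \<in> space D. Z x > real j} = G (t * r ^ j)" for j
      unfolding level G_def ..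
    have first: "integrable D Z" "(\<integral>x. Z x \<partial>D) \<le> (\<Sum>j. 1 * (u ^ j * G t))"
    proof -
      have "z \<le> (\<Sum>j<nat \<lceil>z\<rceil>. 1)" for z :: real
        by (simp add: real_nat_ceiling_ge)
      moreover have "summable (\<lambda>j. 1 * (u ^ j * G t))"
        using lu \<open>0 < u\<close> by (simp add: summable_mult2 summable_geometric)
      ultimately show "integrable D Z" "(\<integral>x. Z x \<partial>D) \<le> (\<Sum>j. 1 * (u ^ j * G t))"
        using integral_le_weighted_tail_sum [OF Zm Z0, of "\<lambda>z. z" "\<lambda>_. 1" "\<lambda>j. u ^ j * G t"] tail elim
        by auto
    qed
    have second: "integrable D (\<lambda>x. (Z x)\<^sup>2)" "(\<integral>x. (Z x)\<^sup>2 \<partial>D) \<le> (\<Sum>j. w j * (u ^ j * G t))"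
    proof -
      have "z\<^sup>2 \<le> (\<Sum>j<nat \<lceil>z\<rceil>. w j)" if "z \<ge> 0" for z :: real
        unfolding sum_w using that by (intro power_mono real_nat_ceiling_ge)
      moreover have "summable (\<lambda>j. w j * (u ^ j * G t))"
        using summable_mult2 [OF summable_w, of "G t"] by (simp add: mult_ac)
      ultimately show "integrable D (\<lambda>x. (Z x)\<^sup>2)" "(\<integral>x. (Z x)\<^sup>2 \<partial>D) \<le> (\<Sum>j. w j * (u ^ j * G t))"
        using integral_le_weighted_tail_sum [OF Zm Z0, of "\<lambda>z. z\<^sup>2" w "\<lambda>j. u ^ j * G t"] tail elim
        by (auto simp: w_def)
    qed
    have lower: "(\<Sum>j. l ^ Suc j * G t) \<le> (\<integral>x. Z x \<partial>D)"
    proof (rule tail_sum_le_integral [OF first(1) Z0])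
      show "l ^ Suc j * G t \<le> measure D {x \<in> space D. Z x > real (Suc j)}" for j
        unfolding tail using elim by blast
      show "summable (\<lambda>j. l ^ Suc j * G t)"
        using lu \<open>l < 1\<close> by (simp add: summable_mult2 summable_geometric summable_mult)
    qed
    have geo: "(\<Sum>j. 1 * (u ^ j * G t)) = 1 / (1 - u) * G t" "(\<Sum>j. l ^ Suc j * G t) = l / (1 - l) * G t"
      using lu \<open>0 < u\<close> \<open>l < 1\<close>
      by (simp_all add: suminf_mult2 [symmetric] suminf_mult suminf_geometric summable_geometric
           summable_mult)
    have "(\<integral>x. log_excess t x \<partial>D) = ln r * (\<integral>x. Z x \<partial>D)"
      unfolding eq by simp
    moreover have "ln r * (\<integral>x. Z x \<partial>D) \<le> ln r * (1 / (1 - u)) * G t"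
      using mult_left_mono [OF first(2), of "ln r"] \<open>ln r > 0\<close> unfolding geo by (simp add: mult_ac)
    moreover have "ln r * (1 / (1 - u)) * G t \<le> (1 / \<alpha> + \<epsilon>) * G t"
      using hi pos [of t] by (intro mult_right_mono) auto
    moreover have "ln r * (l / (1 - l)) * G t \<le> ln r * (\<integral>x. Z x \<partial>D)"
      using mult_left_mono [OF lower, of "ln r"] \<open>ln r > 0\<close> unfolding geo by (simp add: mult_ac)
    moreover have "(1 / \<alpha> - \<epsilon>) * G t \<le> ln r * (l / (1 - l)) * G t"
      using lo pos [of t] by (intro mult_right_mono) auto
    ultimately have mean: "\<bar>(\<integral>x. log_excess t x \<partial>D) - G t / \<alpha>\<bar> \<le> \<epsilon> * G t"
      by (simp add: abs_le_iff algebra_simps)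
    have "(\<Sum>j. w j * (u ^ j * G t)) = (\<Sum>j. w j * u ^ j) * G t"
      using suminf_mult2 [OF summable_w, of "G t"] by (simp add: mult_ac)
    then have "(\<integral>x. (log_excess t x)\<^sup>2 \<partial>D) \<le> C * G t"
      using mult_left_mono [OF second(2), of "(ln r)\<^sup>2"]
      by (simp add: eq power_mult_distrib C_def mult.assoc)
    moreover have "integrable D (\<lambda>x. (log_excess t x)\<^sup>2)"
      using second(1) by (simp add: eq power_mult_distrib)
    ultimately show ?case
      using mean by blast
  qed
  with \<open>C > 0\<close> show thesis
    by (rule that)
qed

section \<open>Levels of the tail\<close>

text \<open>At a zero of \<open>G\<close> the quotient \<open>G s / G s\<close> is 0, so regular variation at \<open>x = 1\<close> excludes zeros near
  infinity, and monotonicity excludes them everywhere.\<close>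

lemma regularly_varying_antimono_pos:
  fixes G :: "real \<Rightarrow> real"
  assumes "regularly_varying G \<rho>" and "antimono G" and "\<And>t. G t \<ge> 0"
  shows "G t > 0"
proof -
  have "((\<lambda>t. G (t * 1) / G t) \<longlongrightarrow> 1) at_top"
    using assms(1) unfolding regularly_varying_def by (metis powr_one_eq_one zero_less_one)
  then have "\<forall>\<^sub>F s in at_top. 0 < G s / G s"
    by (simp add: order_tendsto_iff)
  then have "\<forall>\<^sub>F s in at_top. 0 < G s / G s \<and> t \<le> s"
    using eventually_ge_at_top by (rule eventually_conj)
  then obtain s where "0 < G s / G s" "t \<le> s"
    using eventually_happens' [OF trivial_limit_at_top_linorder] by blast
  then show ?thesis
    using assms(3) [of s] antimonoD [OF assms(2) \<open>t \<le> s\<close>] by (cases "G s = 0") auto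
qed

lemma (in real_distribution) tail_eq_one_minus_cdf: "measure M {t<..} = 1 - cdf M t"
proof -
  have "{t<..} = space M - {..t}"
    by auto
  then show ?thesis
    using prob_compl [of "{..t}"] by (simp add: cdf_def)
qed

lemma (in real_distribution) tail_attains_small_values:
  assumes cont: "continuous_on UNIV (cdf M)" and y: "0 < y" "y \<le> measure M {s<..}"
  obtains t where "s \<le> t" "measure M {t<..} = y"
proof -
  have "\<forall>\<^sub>F t in at_top. 1 - y < cdf M t"
    using order_tendstoD(1) [OF cdf_lim_at_top_prob] y by simp
  then have "\<forall>\<^sub>F t in at_top. 1 - y < cdf M t \<and> s \<le> t"
    using eventually_ge_at_top by (rule eventually_conj)
  then obtain t1 where "1 - y < cdf M t1" "s \<le> t1"
    using eventually_happens' [OF trivial_limit_at_top_linorder] by blast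
  then have "\<exists>t\<ge>s. t \<le> t1 \<and> cdf M t = 1 - y"
    using y cont by (intro IVT' ) (auto simp: tail_eq_one_minus_cdf intro: continuous_on_subset)
  then show thesis
    using that by (auto simp: tail_eq_one_minus_cdf)
qed

section \<open>Uniform closeness over a range of indices\<close>

lemma geometric_bracket:
  fixes q y :: real
  assumes "q > 1" "y \<ge> 1"
  obtains m where "q ^ m \<le> y" "y < q ^ Suc m"
proof -
  define p where "p = (LEAST j. y < q ^ j)"
  have "\<exists>j. y < q ^ j"
    using real_arch_pow [OF assms(1)] .
  then have p: "y < q ^ p"
    unfolding p_def by (rule LeastI_ex)
  then obtain m where m: "p = Suc m"
    using assms(2) by (cases p) auto
  have "\<not> y < q ^ m"
    using not_less_Least [of m "\<lambda>j. y < q ^ j"] m unfolding p_def by auto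
  then show thesis
    using that p m by (auto simp: not_less)
qed

text \<open>The constants of the sandwich. The relative error \<open>\<epsilon>\<close> of the counts must be so small compared
  with \<open>q - 1\<close> that one step of the grid absorbs it; \<open>\<epsilon> = (q - 1) / (2 * q)\<close> achieves this, and
  \<open>q\<close> close to 1 then makes the bounds on Hill's statistic close to \<open>c\<close>.\<close>

lemma grid_ratio:
  fixes c \<delta> :: real
  assumes "c > 0" "\<delta> > 0"
  obtains q \<epsilon> where "q > 1" "\<epsilon> > 0" "1 + \<epsilon> \<le> q" "1 \<le> (1 - \<epsilon>) * q" "0 < c - 2 * \<epsilon>"
    "(c + 2 * \<epsilon>) * q\<^sup>2 < c + \<delta>" "c - \<delta> < (c - 2 * \<epsilon>) / q\<^sup>2"
proof -
  define e :: "real \<Rightarrow> real" where "e q = (q - 1) / (2 * q)" for q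
  have lim: "((\<lambda>q. c - 2 * e q) \<longlongrightarrow> c) (at_right 1)"
       "((\<lambda>q. (c + 2 * e q) * q\<^sup>2) \<longlongrightarrow> c) (at_right 1)"
       "((\<lambda>q. (c - 2 * e q) / q\<^sup>2) \<longlongrightarrow> c) (at_right 1)"
    unfolding e_def by (auto intro!: tendsto_eq_intros)
  have "\<forall>\<^sub>F q in at_right 1. 0 < c - 2 * e q"
    by (rule order_tendstoD(1) [OF lim(1) assms(1)])
  moreover have "\<forall>\<^sub>F q in at_right 1. (c + 2 * e q) * q\<^sup>2 < c + \<delta>"
    by (rule order_tendstoD(2) [OF lim(2)]) (use assms in simp)
  moreover have "\<forall>\<^sub>F q in at_right 1. c - \<delta> < (c - 2 * e q) / q\<^sup>2"
    by (rule order_tendstoD(1) [OF lim(3)]) (use assms in simp)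
  moreover have "\<forall>\<^sub>F q :: real in at_right 1. q > 1"
    by (rule eventually_at_right_less)
  ultimately have "\<forall>\<^sub>F q in at_right 1. q > 1 \<and> 0 < c - 2 * e q \<and> (c + 2 * e q) * q\<^sup>2 < c + \<delta>
      \<and> c - \<delta> < (c - 2 * e q) / q\<^sup>2"
    by eventually_elim auto
  then obtain q where q: "q > 1" "0 < c - 2 * e q" "(c + 2 * e q) * q\<^sup>2 < c + \<delta>"
      "c - \<delta> < (c - 2 * e q) / q\<^sup>2"
    using eventually_happens' [OF trivial_limit_at_right_real] by blast
  have "e q > 0"
    using q(1) by (simp add: e_def)
  moreover have "1 + e q \<le> q" "1 \<le> (1 - e q) * q"
    using q(1) mult_right_mono [of 1 q "q - 1"] by (auto simp: e_def field_simps)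
  ultimately show thesis
    using that q by blast
qed

text \<open>The exceptional event is the union, over the grid levels \<open>q ^ m\<close> from \<open>q ^ m0\<close> up to \<open>n * G s\<close>, of
  the deviation events of the exceedance count and of the sum of logarithmic excesses. The upper end
  keeps the thresholds above \<open>s\<close>, where the moment estimates hold; the lower end makes the sum of
  the Chebyshev bounds small. The factors \<open>q\<close> in \<open>K\<close> and \<open>q\<^sup>2\<close> in \<open>\<kappa>\<close> leave room for the grid points next
  to \<open>k\<close> on which the sandwich relies.\<close>

lemma (in prob_space) hill_H_uniformly_close:
  fixes X :: "nat \<Rightarrow> 'a \<Rightarrow> real" and \<alpha> \<delta> \<eta> :: real
  assumes D: "real_distribution D" and cont: "continuous_on UNIV (cdf D)"
    and \<alpha>: "\<alpha> > 0" and rv: "regularly_varying (\<lambda>t. measure D {t<..}) (- \<alpha>)"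
    and indep: "indep_vars (\<lambda>_. borel) X {1..}"
    and distr: "\<And>i. i \<ge> 1 \<Longrightarrow> distr M borel (X i) = D"
    and \<delta>: "\<delta> > 0" and \<eta>: "\<eta> > 0"
  shows "\<exists>K. \<exists>\<kappa>>0. \<forall>n. \<exists>B\<in>events. prob B \<le> \<eta> \<and>
    (\<forall>\<omega>\<in>space M - B. \<forall>k. 1 \<le> k \<and> k < n \<and> K \<le> real k \<and> real k \<le> \<kappa> * real n
      \<longrightarrow> \<bar>hill_H (\<lambda>i. X i \<omega>) n k - 1 / \<alpha>\<bar> < \<delta>)"
proof -
  interpret D: real_distribution D by fact
  define G where "G t = measure D {t<..}" for t
  have G_pos: "G t > 0" for t
  proof -
    have "antimono G"
      unfolding G_def by (intro antimonoI D.finite_measure_mono) auto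
    then show ?thesis
      using rv regularly_varying_antimono_pos [of G "- \<alpha>" t] by (simp add: G_def [abs_def])
  qed
  obtain q \<epsilon> where q: "q > 1" and \<epsilon>: "\<epsilon> > 0" "1 + \<epsilon> \<le> q" "1 \<le> (1 - \<epsilon>) * q"
    and close: "0 < 1 / \<alpha> - 2 * \<epsilon>" "(1 / \<alpha> + 2 * \<epsilon>) * q\<^sup>2 < 1 / \<alpha> + \<delta>" "1 / \<alpha> - \<delta> < (1 / \<alpha> - 2 * \<epsilon>) / q\<^sup>2"
    using grid_ratio [of "1 / \<alpha>" \<delta>] \<alpha> \<delta> by auto
  obtain C where C: "C > 0" and ev: "\<forall>\<^sub>F t in at_top. integrable D (\<lambda>x. (log_excess t x)\<^sup>2)
    \<and> \<bar>(\<integral>x. log_excess t x \<partial>D) - G t / \<alpha>\<bar> \<le> \<epsilon> * G t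
    \<and> (\<integral>x. (log_excess t x)\<^sup>2 \<partial>D) \<le> C * G t"
    using log_excess_moments [OF D \<alpha> rv _ \<epsilon>(1)] G_pos unfolding G_def by blast
  have "\<forall>\<^sub>F s in at_top. \<forall>t\<ge>s. integrable D (\<lambda>x. (log_excess t x)\<^sup>2)
    \<and> \<bar>(\<integral>x. log_excess t x \<partial>D) - G t / \<alpha>\<bar> \<le> \<epsilon> * G t
    \<and> (\<integral>x. (log_excess t x)\<^sup>2 \<partial>D) \<le> C * G t"
    by (rule eventually_all_ge_at_top [OF ev])
  from eventually_conj [OF eventually_gt_at_top [of 0] this] obtain s where s: "s > 0"
    and moments: "\<And>t. t \<ge> s \<Longrightarrow> integrable D (\<lambda>x. (log_excess t x)\<^sup>2)"
      "\<And>t. t \<ge> s \<Longrightarrow> \<bar>(\<integral>x. log_excess t x \<partial>D) - G t / \<alpha>\<bar> \<le> \<epsilon> * G t"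
      "\<And>t. t \<ge> s \<Longrightarrow> (\<integral>x. (log_excess t x)\<^sup>2 \<partial>D) \<le> C * G t"
    using eventually_happens' [OF trivial_limit_at_top_linorder] by blast
  have "\<exists>t. s \<le> t \<and> G t = y" if "0 < y" "y \<le> G s" for y
    using D.tail_attains_small_values [OF cont] that unfolding G_def by metis
  then obtain \<tau> where \<tau>: "\<And>y. 0 < y \<Longrightarrow> y \<le> G s \<Longrightarrow> s \<le> \<tau> y \<and> G (\<tau> y) = y"
    by metis
  \<comment> \<open>The two Chebyshev bounds at level \<open>m\<close> add up to \<open>A * (1 / q) ^ m\<close>; the choice of \<open>m0\<close> brings the
    geometric series from \<open>m0\<close> on below \<open>\<eta>\<close>.\<close>
  define A where "A = (1 + C) / \<epsilon>\<^sup>2"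
  have A: "A > 0"
    using C \<epsilon> by (simp add: A_def)
  obtain m0 where m0: "(1 / q) ^ m0 < \<eta> * (1 - 1 / q) / A"
    using real_arch_pow_inv [of "\<eta> * (1 - 1 / q) / A" "1 / q"] q \<eta> A by auto
  show ?thesis
  proof (rule exI [of _ "q ^ Suc m0"], rule exI [of _ "G s / q\<^sup>2"], intro conjI allI)
    show "G s / q\<^sup>2 > 0"
      using G_pos q by simp
    fix n
    define I where "I = {m. m0 \<le> m \<and> q ^ m \<le> G s * real n}"
    define T where "T m = \<tau> (q ^ m / real n)" for m
    define N where "N m \<omega> = (\<Sum>i=1..n. indicator {T m<..} (X i \<omega>) :: real)" for m \<omega>
    define S where "S m \<omega> = (\<Sum>i=1..n. log_excess (T m) (X i \<omega>))" for m \<omega>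
    define B1 where "B1 m = {\<omega> \<in> space M. \<epsilon> * q ^ m \<le> \<bar>N m \<omega> - q ^ m\<bar>}" for m
    define B2 where "B2 m = {\<omega> \<in> space M. \<epsilon> * q ^ m \<le> \<bar>S m \<omega> - real n * (\<integral>x. log_excess (T m) x \<partial>D)\<bar>}" for m
    have rvX: "i \<in> {1..n} \<Longrightarrow> random_variable borel (X i)" for i
      using indep by (auto simp: indep_vars_def)
    have N_meas [measurable]: "N m \<in> borel_measurable M" for m
      unfolding N_def using rvX by (intro borel_measurable_sum measurable_compose [OF _ borel_measurable_indicator]) auto
    have S_meas [measurable]: "S m \<in> borel_measurable M" for m
      unfolding S_def using rvX by (intro borel_measurable_sum measurable_compose [OF _ log_excess_measurable]) auto
    have events: "B1 m \<in> events" "B2 m \<in> events" for m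
      unfolding B1_def B2_def by measurable
    have n: "real n > 0" if "m \<in> I" for m
    proof -
      have "0 < q ^ m"
        using q by simp
      then show ?thesis
        using that by (cases n) (auto simp: I_def)
    qed
    have T: "s \<le> T m" "real n * G (T m) = q ^ m" if "m \<in> I" for m
      using \<tau> [of "q ^ m / real n"] n [OF that] that q by (auto simp: T_def I_def field_simps)
    have finite: "finite I"
    proof -
      obtain j where j: "G s * real n < q ^ j"
        using real_arch_pow [OF q] by blast
      have "m < j" if "m \<in> I" for m
        by (rule power_less_imp_less_exp [OF q]) (use that j in \<open>simp add: I_def\<close>)
      then show ?thesis
        by (meson finite_nat_set_iff_bounded)
    qed
    have scale: "c * q ^ m / (\<epsilon> * q ^ m)\<^sup>2 = c / \<epsilon>\<^sup>2 * (1 / q) ^ m" for c m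
      using q by (simp add: power2_eq_square field_simps)
    have small: "prob (B1 m \<union> B2 m) \<le> A * (1 / q) ^ m" if m: "m \<in> I" for m
    proof -
      have sq: "(\<lambda>x. (indicator {T m<..} x)\<^sup>2) = (indicator {T m<..} :: real \<Rightarrow> real)"
        by (auto simp: fun_eq_iff indicator_def)
      have mean: "(\<integral>x. indicator {T m<..} x \<partial>D) = G (T m)"
        by (simp add: G_def)
      have int: "integrable D (indicator {T m<..} :: real \<Rightarrow> real)"
        by (simp add: D.emeasure_eq_measure)
      have "\<epsilon> * q ^ m > 0"
        using \<epsilon> q by simp
      then have "prob (B1 m) \<le> 1 * q ^ m / (\<epsilon> * q ^ m)\<^sup>2"
        unfolding B1_def N_def mult_1
        by (intro iid_sum_deviation [OF indep distr, of "indicator {T m<..}" "\<epsilon> * q ^ m" n,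
            unfolded sq mean T(2) [OF m]] int) measurable
      then have 1: "prob (B1 m) \<le> 1 / \<epsilon>\<^sup>2 * (1 / q) ^ m"
        unfolding scale .
      have "prob (B2 m) \<le> real n * (\<integral>x. (log_excess (T m) x)\<^sup>2 \<partial>D) / (\<epsilon> * q ^ m)\<^sup>2"
        using iid_sum_deviation [OF indep distr, of "log_excess (T m)" "\<epsilon> * q ^ m" n]
          moments(1) [OF T(1) [OF m]] \<epsilon> q by (simp add: B2_def S_def)
      also have "\<dots> \<le> real n * (C * G (T m)) / (\<epsilon> * q ^ m)\<^sup>2"
        using moments(3) [OF T(1) [OF m]] by (intro divide_right_mono mult_left_mono) auto
      also have "\<dots> = C * q ^ m / (\<epsilon> * q ^ m)\<^sup>2"
        using T(2) [OF m] by (simp add: mult_ac)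
      finally have 2: "prob (B2 m) \<le> C / \<epsilon>\<^sup>2 * (1 / q) ^ m"
        unfolding scale .
      have "prob (B1 m \<union> B2 m) \<le> prob (B1 m) + prob (B2 m)"
        using events by (rule measure_Un_le)
      also have "\<dots> \<le> A * (1 / q) ^ m"
        using 1 2 by (simp add: A_def add_divide_distrib distrib_right)
      finally show ?thesis .
    qed
    define B where "B = (\<Union>m\<in>I. B1 m \<union> B2 m)"
    show "\<exists>B\<in>events. prob B \<le> \<eta> \<and>
      (\<forall>\<omega>\<in>space M - B. \<forall>k. 1 \<le> k \<and> k < n \<and> q ^ Suc m0 \<le> real k \<and> real k \<le> G s / q\<^sup>2 * real n
      \<longrightarrow> \<bar>hill_H (\<lambda>i. X i \<omega>) n k - 1 / \<alpha>\<bar> < \<delta>)"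
    proof (intro bexI conjI ballI allI impI)
      show "B \<in> events"
        unfolding B_def using events finite by auto
      have "prob B \<le> (\<Sum>m\<in>I. prob (B1 m \<union> B2 m))"
        unfolding B_def using events finite by (intro finite_measure_subadditive_finite) auto
      also have "\<dots> \<le> (\<Sum>m\<in>I. A * (1 / q) ^ m)"
        by (intro sum_mono small)
      also have "\<dots> = A * (1 / q) ^ m0 * (\<Sum>j\<in>(\<lambda>m. m - m0) ` I. (1 / q) ^ j)"
        by (subst sum.reindex) (auto simp: inj_on_def I_def sum_distrib_left mult.assoc simp flip: power_add intro!: sum.cong)
      also have "\<dots> \<le> A * (1 / q) ^ m0 * (\<Sum>j. (1 / q) ^ j)"
        using q A finite by (intro mult_left_mono sum_le_suminf summable_geometric) auto
      also have "\<dots> = A * (1 / q) ^ m0 / (1 - 1 / q)"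
        using q by (subst suminf_geometric) auto
      also have "\<dots> \<le> \<eta>"
        using m0 q A by (simp add: pos_less_divide_eq pos_divide_le_eq less_imp_le mult_ac)
      finally show "prob B \<le> \<eta>" .
      fix \<omega> k
      assume \<omega>: "\<omega> \<in> space M - B"
        and "1 \<le> k \<and> k < n \<and> q ^ Suc m0 \<le> real k \<and> real k \<le> G s / q\<^sup>2 * real n"
      then have k: "1 \<le> k" "k < n" "q ^ Suc m0 \<le> real k" "real k \<le> G s / q\<^sup>2 * real n"
        by auto
      have count: "real (card {i \<in> {1..n}. T m < X i \<omega>}) = N m \<omega>" for m
        by (simp add: N_def indicator_def sum.If_cases Int_def)
      have N_close: "\<bar>N m \<omega> - q ^ m\<bar> < \<epsilon> * q ^ m" if "m \<in> I" for m
        using \<omega> that by (auto simp: B_def B1_def not_le)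
      have S_close: "\<bar>S m \<omega> - q ^ m / \<alpha>\<bar> < 2 * \<epsilon> * q ^ m" if m: "m \<in> I" for m
      proof -
        have "\<bar>S m \<omega> - real n * (\<integral>x. log_excess (T m) x \<partial>D)\<bar> < \<epsilon> * q ^ m"
          using \<omega> m by (auto simp: B_def B2_def not_le)
        moreover have "real n * \<bar>(\<integral>x. log_excess (T m) x \<partial>D) - G (T m) / \<alpha>\<bar> \<le> real n * (\<epsilon> * G (T m))"
          using moments(2) [OF T(1) [OF m]] by (intro mult_left_mono) auto
        moreover have "real n * \<bar>(\<integral>x. log_excess (T m) x \<partial>D) - G (T m) / \<alpha>\<bar>
            = \<bar>real n * (\<integral>x. log_excess (T m) x \<partial>D) - q ^ m / \<alpha>\<bar>"
        proof -
          have "real n * \<bar>c\<bar> = \<bar>real n * c\<bar>" for c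
            by (simp add: abs_mult)
          then show ?thesis
            unfolding T(2) [OF m, symmetric] by (simp add: right_diff_distrib)
        qed
        moreover have "real n * (\<epsilon> * G (T m)) = \<epsilon> * q ^ m"
          unfolding T(2) [OF m, symmetric] by simp
        moreover have "\<bar>x - z\<bar> < 2 * d" if "\<bar>x - y\<bar> < d" "\<bar>y - z\<bar> \<le> d" for x y z d :: real
          using that by linarith
        ultimately show ?thesis
          by (metis mult.assoc)
      qed
      obtain m where m: "q ^ m \<le> real k" "real k < q ^ Suc m"
        using geometric_bracket [OF q, of "real k"] k(1) by auto
      have "q ^ Suc m0 < q ^ Suc m"
        using k(3) m(2) by linarith
      then have "m0 < m"
        using q by (simp add: power_strict_increasing_iff del: power_Suc)
      then obtain a where a: "m = Suc a" "m0 \<le> a"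
        by (cases m) auto
      have "q ^ (a + 3) = q\<^sup>2 * q ^ m"
        by (simp add: a power_add power2_eq_square power3_eq_cube)
      also have "\<dots> \<le> q\<^sup>2 * (G s / q\<^sup>2 * real n)"
        using m(1) k(4) by (intro mult_left_mono) auto
      also have "\<dots> = G s * real n"
        using q by simp
      finally have top: "q ^ (a + 3) \<le> G s * real n" .
      moreover have "q ^ a \<le> q ^ (a + 3)"
        using q by (intro power_increasing) auto
      ultimately have aI: "a \<in> I" "a + 3 \<in> I"
        using a(2) by (auto simp: I_def)
      \<comment> \<open>The index \<open>k\<close> lies in \<open>[q ^ (a + 1), q ^ (a + 2))\<close>. Level \<open>a\<close> has at most \<open>k\<close> exceedances, level
        \<open>a + 3\<close> more than \<open>k\<close>.\<close>
      have "N a \<omega> < (1 + \<epsilon>) * q ^ a"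
        using N_close [OF aI(1)] by (simp add: algebra_simps)
      also have "\<dots> \<le> q * q ^ a"
        using \<epsilon> q by (intro mult_right_mono) auto
      also have "\<dots> \<le> real k"
        using m a by simp
      finally have few: "card {i \<in> {1..n}. T a < X i \<omega>} \<le> k"
        by (simp flip: count)
      have "real k < 1 * q ^ (a + 2)"
        using m a by simp
      also have "\<dots> \<le> ((1 - \<epsilon>) * q) * q ^ (a + 2)"
        using \<epsilon> q by (intro mult_right_mono) auto
      also have "\<dots> = (1 - \<epsilon>) * q ^ (a + 3)"
        by (simp add: power_add power2_eq_square power3_eq_cube)
      also have "\<dots> < N (a + 3) \<omega>"
        using N_close [OF aI(2)] by (simp add: algebra_simps)
      finally have many: "k < card {i \<in> {1..n}. T (a + 3) < X i \<omega>}"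
        by (simp flip: count)
      have "T (a + 3) > 0"
        using T(1) [OF aI(2)] s by simp
      note H = hill_H_sandwich [OF k(1,2) this few many, folded S_def]
      have "1 / \<alpha> - \<delta> < (1 / \<alpha> - 2 * \<epsilon>) / q\<^sup>2"
        by (rule close)
      also have "\<dots> = (1 / \<alpha> - 2 * \<epsilon>) * q ^ a / q ^ (a + 2)"
        using q by (simp add: power_add power2_eq_square)
      also have "\<dots> \<le> (1 / \<alpha> - 2 * \<epsilon>) * q ^ a / real k"
        using m a k close q by (intro divide_left_mono) auto
      also have "\<dots> \<le> S a \<omega> / real k"
        using S_close [OF aI(1)] by (intro divide_right_mono) (auto simp: algebra_simps abs_less_iff)
      also have "\<dots> \<le> hill_H (\<lambda>i. X i \<omega>) n k"
        by (rule H)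
      finally have lower: "1 / \<alpha> - \<delta> < hill_H (\<lambda>i. X i \<omega>) n k" .
      have "hill_H (\<lambda>i. X i \<omega>) n k \<le> S (a + 3) \<omega> / real k"
        by (rule H)
      also have "\<dots> \<le> (1 / \<alpha> + 2 * \<epsilon>) * q ^ (a + 3) / real k"
        using S_close [OF aI(2)] by (intro divide_right_mono) (auto simp: algebra_simps abs_less_iff)
      also have "\<dots> \<le> (1 / \<alpha> + 2 * \<epsilon>) * q ^ (a + 3) / q ^ (a + 1)"
        using m a k close \<epsilon> q by (intro divide_left_mono mult_nonneg_nonneg) auto
      also have "\<dots> = (1 / \<alpha> + 2 * \<epsilon>) * q\<^sup>2"
        using q by (simp add: power_add power2_eq_square power3_eq_cube)
      also have "\<dots> < 1 / \<alpha> + \<delta>"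
        by (rule close)
      finally show "\<bar>hill_H (\<lambda>i. X i \<omega>) n k - 1 / \<alpha>\<bar> < \<delta>"
        using lower by (simp add: abs_less_iff)
    qed
  qed
qed

section \<open>Consistency of Hill's estimator\<close>

theorem theorem2p2:
  fixes \<alpha> :: real
    and F :: "real \<Rightarrow> real"
    and D :: "real measure"
    and M :: "'a measure"
    and X :: "nat \<Rightarrow> 'a \<Rightarrow> real"
    and k :: "nat \<Rightarrow> 'a \<Rightarrow> nat"
  assumes "\<alpha> > 0"
    and "real_distribution D" and "F = cdf D"
    and "continuous_on UNIV F"
    and "\<forall>x<1. F x = 0"
    and "regularly_varying (\<lambda>t. 1 - F t) (- \<alpha>)"
    and "prob_space M"
    and "prob_space.indep_vars M (\<lambda>_. borel) X {1..}"
    and "\<forall>i\<ge>1. distr M borel (X i) = D"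
    and "random_intermediate_sequence M k"
  shows "tendsto_in_prob M (\<lambda>n \<omega>. hill_estimator (\<lambda>i. X i \<omega>) n (k n \<omega>)) \<alpha>"
proof -
  interpret prob_space M by fact
  have rv: "regularly_varying (\<lambda>t. measure D {t<..}) (- \<alpha>)"
    using assms(2,3,6) by (simp add: real_distribution.tail_eq_one_minus_cdf)
  have distr: "\<And>i. i \<ge> 1 \<Longrightarrow> distr M borel (X i) = D"
    using assms(9) by blast
  have cont: "continuous_on UNIV (cdf D)"
    using assms(3,4) by simp
  have rvX: "i \<in> {1..n} \<Longrightarrow> random_variable borel (X i)" for i n :: nat
    using assms(8) by (auto simp: indep_vars_def)
  have k: "k n \<in> measurable M (count_space UNIV)" "\<And>\<omega>. \<omega> \<in> space M \<Longrightarrow> k n \<omega> \<in> {1..n - 1}"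
    if "n \<ge> 2" for n
    using assms(10) that by (auto simp: random_intermediate_sequence_def)
  have k_large: "(\<lambda>n. prob {\<omega> \<in> space M. real (k n \<omega>) > K}) \<longlonglongrightarrow> 1" for K
    using assms(10) by (simp add: random_intermediate_sequence_def tendsto_infinity_in_prob_def)
  have k_small: "(\<lambda>n. prob {\<omega> \<in> space M. \<bar>real (k n \<omega>) / real n - 0\<bar> > \<kappa>}) \<longlonglongrightarrow> 0" if "\<kappa> > 0" for \<kappa>
    using assms(10) that unfolding random_intermediate_sequence_def tendsto_in_prob_def by blast
  have meas: "(\<lambda>\<omega>. hill_estimator (\<lambda>i. X i \<omega>) n (k n \<omega>)) \<in> borel_measurable M" if "n \<ge> 2" for n
    by (rule hill_estimator_measurable [OF rvX k [OF that]])
  show ?thesis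
    unfolding tendsto_in_prob_def
  proof (intro conjI allI impI)
    show "\<forall>\<^sub>F n in sequentially. (\<lambda>\<omega>. hill_estimator (\<lambda>i. X i \<omega>) n (k n \<omega>)) \<in> borel_measurable M"
      using meas by (auto simp: eventually_sequentially)
    fix \<epsilon> :: real assume "\<epsilon> > 0"
    define E where "E n = {\<omega> \<in> space M. \<bar>hill_estimator (\<lambda>i. X i \<omega>) n (k n \<omega>) - \<alpha>\<bar> > \<epsilon>}" for n
    have "isCont inverse (1 / \<alpha>)"
      using \<open>\<alpha> > 0\<close> by (intro continuous_intros) auto
    then obtain \<delta> where "\<delta> > 0" and \<delta>: "\<And>h. \<bar>h - 1 / \<alpha>\<bar> < \<delta> \<Longrightarrow> \<bar>inverse h - \<alpha>\<bar> < \<epsilon>"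
      using \<open>\<epsilon> > 0\<close> \<open>\<alpha> > 0\<close> unfolding continuous_at_eps_delta by (auto simp: dist_real_def)
    have "\<forall>\<^sub>F n in sequentially. prob (E n) < \<eta>" if "\<eta> > 0" for \<eta>
    proof -
      have "\<eta> / 3 > 0"
        using that by simp
      obtain K \<kappa> where "\<kappa> > 0" and uniform: "\<And>n. \<exists>B\<in>events. prob B \<le> \<eta> / 3 \<and>
          (\<forall>\<omega>\<in>space M - B. \<forall>k. 1 \<le> k \<and> k < n \<and> K \<le> real k \<and> real k \<le> \<kappa> * real n
            \<longrightarrow> \<bar>hill_H (\<lambda>i. X i \<omega>) n k - 1 / \<alpha>\<bar> < \<delta>)"
        using hill_H_uniformly_close [OF assms(2) cont assms(1) rv assms(8) distr \<open>\<delta> > 0\<close> \<open>\<eta> / 3 > 0\<close>]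
        by blast
      have "\<forall>\<^sub>F n in sequentially. prob {\<omega> \<in> space M. real (k n \<omega>) > K} > 1 - \<eta> / 3"
        using order_tendstoD(1) [OF k_large] \<open>\<eta> > 0\<close> by simp
      moreover have "\<forall>\<^sub>F n in sequentially. prob {\<omega> \<in> space M. \<bar>real (k n \<omega>) / real n - 0\<bar> > \<kappa>} < \<eta> / 3"
        using order_tendstoD(2) [OF k_small [OF \<open>\<kappa> > 0\<close>] \<open>\<eta> / 3 > 0\<close>] .
      ultimately show ?thesis
        using eventually_ge_at_top [of 2]
      proof eventually_elim
        case (elim n)
        let ?L = "{\<omega> \<in> space M. real (k n \<omega>) > K}"
        let ?R = "{\<omega> \<in> space M. \<bar>real (k n \<omega>) / real n - 0\<bar> > \<kappa>}"
        obtain B where B: "B \<in> events" "prob B \<le> \<eta> / 3"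
          and good: "\<And>\<omega> k. \<omega> \<in> space M - B \<Longrightarrow> 1 \<le> k \<Longrightarrow> k < n \<Longrightarrow> K \<le> real k \<Longrightarrow> real k \<le> \<kappa> * real n
            \<Longrightarrow> \<bar>hill_H (\<lambda>i. X i \<omega>) n k - 1 / \<alpha>\<bar> < \<delta>"
          using uniform [of n] by blast
        note [measurable] = k(1) [OF elim(3)]
        have L: "?L \<in> events" and R: "?R \<in> events"
          by measurable
        have "E n \<subseteq> B \<union> ((space M - ?L) \<union> ?R)"
        proof
          fix \<omega> assume \<omega>: "\<omega> \<in> E n"
          show "\<omega> \<in> B \<union> ((space M - ?L) \<union> ?R)"
          proof (rule ccontr)
            assume "\<omega> \<notin> B \<union> ((space M - ?L) \<union> ?R)"
            then have "\<omega> \<in> space M - B" "real (k n \<omega>) > K" "real (k n \<omega>) \<le> \<kappa> * real n"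
              using \<omega> elim(3) by (auto simp: E_def field_simps)
            moreover have "1 \<le> k n \<omega>" "k n \<omega> < n"
              using k(2) [OF elim(3), of \<omega>] \<omega> elim(3) by (auto simp: E_def)
            ultimately have "\<bar>hill_H (\<lambda>i. X i \<omega>) n (k n \<omega>) - 1 / \<alpha>\<bar> < \<delta>"
              using good by simp
            then show False
              using \<delta> \<omega> by (force simp: E_def hill_estimator_def)
          qed
        qed
        then have "prob (E n) \<le> prob (B \<union> ((space M - ?L) \<union> ?R))"
          using B L R by (intro finite_measure_mono) auto
        also have "\<dots> \<le> prob B + (prob (space M - ?L) + prob ?R)"
          using B L R by (intro order_trans [OF measure_Un_le] add_left_mono measure_Un_le) auto
        also have "\<dots> < \<eta>"
          using B(2) elim prob_compl [OF L] by simp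
        finally show ?case .
      qed
    qed
    then show "(\<lambda>n. prob {\<omega> \<in> space M. \<bar>hill_estimator (\<lambda>i. X i \<omega>) n (k n \<omega>) - \<alpha>\<bar> > \<epsilon>}) \<longlonglongrightarrow> 0"
      unfolding E_def [symmetric]
      by (intro order_tendstoI) (auto intro: always_eventually less_le_trans [OF _ measure_nonneg])
  qed
qed

end
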